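(* Let $G$ be a claw-free graph with maximum degree $\Delta(G)$ and chromatic polynomial $\chi_G$. If $\chi_G(z)=0$ for some $z\in\mathbb{C}$, then $|z|\leq 3.81\,\Delta(G)$.
   Context: Graphs are finite and simple. A graph is claw-free if it does not contain the tree on $4$ vertices with $3$ leaves (i.e. $K_{1,3}$) as an induced subgraph. The chromatic polynomial $\chi_G(x)$ of an $n$-vertex graph $G$ is the unique monic polynomial of degree $n$ such that for every positive integer $q$, $\chi_G(q)$ equals the number of proper $q$-colorings of $G$. *)

theory Defs
  imports
    "HOL-Computational_Algebra.Polynomial"
    "Graph_Theory.Graph_Theory"
begin

text \<open>
  Finite simple graphs are those of the locale \<^locale>\<open>graph\<close>: finite, loop-free, symmetric
  digraphs without parallel arcs, an edge being a pair of opposite arcs. Hence the degree of a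
  vertex is its out-degree.
\<close>

text \<open>The graph without vertices has maximum degree 0.\<close>

definition max_degree :: "('a, 'b) pre_digraph \<Rightarrow> nat" where
  "max_degree G = Max (insert 0 (out_degree G ` verts G))"

definition claw_free :: "('a, 'b) pre_digraph \<Rightarrow> bool" where
  "claw_free G \<longleftrightarrow> \<not> (\<exists>H. induced_subgraph H G \<and> complete_bipartite_digraph 1 3 H)"

definition proper_colorings :: "nat \<Rightarrow> ('a, 'b) pre_digraph \<Rightarrow> ('a \<Rightarrow> nat) set" where
  "proper_colorings q G =
     {c \<in> verts G \<rightarrow>\<^sub>E {..<q}. \<forall>(u, v) \<in> arcs_ends G. c u \<noteq> c v}"

definition is_chromatic_poly :: "('a, 'b) pre_digraph \<Rightarrow> complex poly \<Rightarrow> bool" where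
  "is_chromatic_poly G p \<longleftrightarrow>
     lead_coeff p = 1 \<and> degree p = card (verts G) \<and>
     (\<forall>q>0. poly p (of_nat q) = of_nat (card (proper_colorings q G)))"

text \<open>The description is justified by \<open>ex1_chromatic_poly\<close> below.\<close>

definition chromatic_poly :: "('a, 'b) pre_digraph \<Rightarrow> complex poly" where
  "chromatic_poly G = (THE p. is_chromatic_poly G p)"

lemma chromatic_poly_unique:
  assumes "is_chromatic_poly G p" "is_chromatic_poly G p'"
  shows "p = p'"
proof (rule poly_eqI_degree[where A = "of_nat ` {0<..degree p + degree p' + 1}"])
  show "poly p x = poly p' x" if "x \<in> of_nat ` {0<..degree p + degree p' + 1}" for x
    using that assms unfolding is_chromatic_poly_def by auto
  have "card (of_nat ` {0<..degree p + degree p' + 1} :: complex set) = degree p + degree p' + 1"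
    by (subst card_image) (auto simp: inj_on_def)
  then show "card (of_nat ` {0<..degree p + degree p' + 1} :: complex set) > degree p"
    "card (of_nat ` {0<..degree p + degree p' + 1} :: complex set) > degree p'"
    by simp_all
qed

text \<open>Existence, by deletion and contraction.\<close>

lemma ex_coloring_poly:
  fixes V :: "'a set" and R :: "('a \<times> 'a) set"
  assumes "finite V" "R \<subseteq> V \<times> V" "irrefl R"
  shows "\<exists>p :: complex poly. lead_coeff p = 1 \<and> degree p = card V \<and>
    (\<forall>q. poly p (of_nat q) =
       of_nat (card {c \<in> V \<rightarrow>\<^sub>E {..<q}. \<forall>(u, v) \<in> R. c u \<noteq> c v}))"
  using assms
proof (induction "card R" arbitrary: R V rule: less_induct)
  case less
  define C where "C = (\<lambda>V (R :: ('a \<times> 'a) set) q.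
    {c \<in> V \<rightarrow>\<^sub>E {..<q::nat}. \<forall>(u, v) \<in> R. c u \<noteq> c v})"
  have finR: "finite R"
    using less.prems finite_subset by blast
  have finC: "finite (C V' R' q)" if "finite V'" for V' R' q
    unfolding C_def using that by (intro finite_Collect_conjI disjI1) (simp add: finite_PiE)
  have IH: "\<exists>p :: complex poly. lead_coeff p = 1 \<and> degree p = card V' \<and>
      (\<forall>q. poly p (of_nat q) = of_nat (card (C V' R' q)))"
    if "card R' < card R" "finite V'" "R' \<subseteq> V' \<times> V'" "irrefl R'" for V' R'
    using less.hyps[OF that] unfolding C_def .
  have "\<exists>p :: complex poly. lead_coeff p = 1 \<and> degree p = card V \<and>
      (\<forall>q. poly p (of_nat q) = of_nat (card (C V R q)))"
  proof (cases "R = {}")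
    case True
    have "card (C V R q) = q ^ card V" for q
      using True less.prems(1) by (simp add: C_def card_PiE)
    then show ?thesis
      by (intro exI[of _ "monom 1 (card V)"]) (simp add: degree_monom_eq poly_monom)
  next
    case False
    then obtain u v where uv: "(u, v) \<in> R" by auto
    define R' where "R' = R - {(u, v)}"
    have R: "R = insert (u, v) R'" using uv by (auto simp: R'_def)
    have ne: "u \<noteq> v" using uv less.prems(3) by (auto simp: irrefl_def)
    have mem: "u \<in> V" "v \<in> V" using uv less.prems(2) by auto
    have R'V: "R' \<subseteq> V \<times> V" "irrefl R'"
      using less.prems by (auto simp: R'_def irrefl_def)
    have card: "card R' < card R"
      unfolding R'_def using finR uv by (rule card_Diff1_less)
    obtain p :: "complex poly" where p: "lead_coeff p = 1" "degree p = card V"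
      "\<And>q. poly p (of_nat q) = of_nat (card (C V R' q))"
      using IH[OF card less.prems(1) R'V] by blast
    show ?thesis
    proof (cases "(v, u) \<in> R'")
      case True
      then have "C V R q = C V R' q" for q
        unfolding C_def R by fastforce
      then show ?thesis using p by metis
    next
      case nvu: False
      define h where "h = (\<lambda>x. if x = v then u else x)"
      define S where "S = map_prod h h ` R'"
      have "card S \<le> card R'"
        unfolding S_def using finR R'_def by (intro card_image_le) auto
      then have cS: "card S < card R" using card by simp
      have SV: "S \<subseteq> (V - {v}) \<times> (V - {v})"
        unfolding S_def h_def using R'V(1) mem ne by (auto split: if_splits)
      have "(u, v) \<notin> R'" by (simp add: R'_def)
      then have irrS: "irrefl S"
        using R'V(2) nvu unfolding S_def h_def irrefl_def by (auto split: if_splits)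
      obtain r :: "complex poly" where r: "lead_coeff r = 1" "degree r = card (V - {v})"
        "\<And>q. poly r (of_nat q) = of_nat (card (C (V - {v}) S q))"
        using IH[OF cS _ SV irrS] less.prems(1) by blast
      have cS_iff: "(\<forall>(a, b) \<in> S. c a \<noteq> c b) \<longleftrightarrow> (\<forall>(a, b) \<in> R'. c (h a) \<noteq> c (h b))" for c :: "'a \<Rightarrow> nat"
        unfolding S_def by (auto simp: case_prod_beta)
      have count: "card (C V R' q) = card (C V R q) + card (C (V - {v}) S q)" for q
      proof -
        let ?D = "{c \<in> C V R' q. c u = c v}"
        have un: "C V R' q = C V R q \<union> ?D" and dis: "C V R q \<inter> ?D = {}"
          unfolding C_def R by auto
        have h: "c (h x) = c x" if "c u = c v" for c :: "'a \<Rightarrow> nat" and x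
          using that by (simp add: h_def)
        have "bij_betw (\<lambda>c. restrict c (V - {v})) ?D (C (V - {v}) S q)"
        proof (rule bij_betw_byWitness[where f' = "\<lambda>c. c(v := c u)"])
          show "\<forall>c\<in>?D. (restrict c (V - {v}))(v := restrict c (V - {v}) u) = c"
            using mem ne by (auto simp: C_def fun_eq_iff PiE_def extensional_def)
          show "\<forall>c\<in>C (V - {v}) S q. restrict (c(v := c u)) (V - {v}) = c"
            by (auto simp: C_def fun_eq_iff PiE_def extensional_def)
          show "(\<lambda>c. restrict c (V - {v})) ` ?D \<subseteq> C (V - {v}) S q"
          proof (clarify)
            fix c assume c: "c \<in> C V R' q" "c u = c v"
            have "\<forall>(a, b) \<in> S. c a \<noteq> c b"
              unfolding cS_iff using c h[OF c(2)] by (auto simp: C_def)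
            then show "restrict c (V - {v}) \<in> C (V - {v}) S q"
              using c(1) SV by (fastforce simp: C_def)
          qed
          show "(\<lambda>c. c(v := c u)) ` C (V - {v}) S q \<subseteq> ?D"
          proof (clarify, intro conjI)
            fix c assume c: "c \<in> C (V - {v}) S q"
            have eq: "c (h x) = (c(v := c u)) x" for x
              by (simp add: h_def)
            have "\<forall>(a, b) \<in> R'. (c(v := c u)) a \<noteq> (c(v := c u)) b"
              using c cS_iff[of c] unfolding eq by (simp add: C_def)
            moreover have "c(v := c u) \<in> V \<rightarrow>\<^sub>E {..<q}"
              using c mem ne by (auto simp: C_def PiE_def extensional_def Pi_def)
            ultimately show "c(v := c u) \<in> C V R' q"
              unfolding C_def by blast
            show "(c(v := c u)) u = (c(v := c u)) v"
              using ne by simp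
          qed
        qed
        then have "card ?D = card (C (V - {v}) S q)"
          by (rule bij_betw_same_card)
        moreover have "card (C V R' q) = card (C V R q) + card ?D"
          using card_Un_disjoint[OF finC finite_subset[OF _ finC] dis] un less.prems(1)
          by (metis (no_types, lifting) Un_upper2)
        ultimately show ?thesis by simp
      qed
      have "card (V - {v}) < card V"
        using less.prems(1) mem by (intro card_Diff1_less) auto
      then have deg: "degree r < degree p" using p r by simp
      have "degree (p - r) = degree p"
        using degree_add_eq_left[of "- r" p] deg by simp
      moreover have "coeff (p - r) (degree p) = 1"
        using p(1) deg by (simp add: coeff_eq_0)
      moreover have "poly (p - r) (of_nat q) = of_nat (card (C V R q))" for q
        using count[of q] by (simp add: p r)
      ultimately show ?thesis using p(2) by metis
    qed
  qed
  then show ?case unfolding C_def .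
qed

lemma ex1_chromatic_poly:
  assumes "graph G"
  shows "\<exists>!p. is_chromatic_poly G p"
proof -
  interpret graph G by fact
  have "arcs_ends G \<subseteq> verts G \<times> verts G" "irrefl (arcs_ends G)"
    using no_loops by (auto simp: arcs_ends_conv irrefl_def)
  from ex_coloring_poly[OF finite_verts this]
  have "\<exists>p. is_chromatic_poly G p"
    unfolding is_chromatic_poly_def proper_colorings_def by blast
  then show ?thesis
    using chromatic_poly_unique by blast
qed

lemma is_chromatic_poly_chromatic_poly:
  "graph G \<Longrightarrow> is_chromatic_poly G (chromatic_poly G)"
  unfolding chromatic_poly_def by (rule theI') (rule ex1_chromatic_poly)

end

theory Submission
  imports Defs
begin

text \<open>
  Let \<open>E(V, Y)\<close> be the number of \<open>q\<close>-colorings of \<open>G[V]\<close> that are constant on \<open>Y\<close>, a polynomial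
  in \<open>q\<close>. A coloring of \<open>G[V - u]\<close> constant on \<open>Y\<close> extends to one constant on \<open>Y \<union> {u}\<close> iff
  the color of \<open>Y\<close> is missing on \<open>N(u)\<close>. As \<open>G\<close> is claw-free, a color occurs at most twice
  on \<open>N(u)\<close>, so inclusion-exclusion stops after two steps and gives
  \<open>E(V, Y \<union> {u}) = E(V - u, Y) - (\<Sum>z. E(V - u, Y \<union> {z})) + (\<Sum>z z'. E(V - u, Y \<union> {z, z'}))\<close>,
  where \<open>z\<close> runs over \<open>N(u)\<close> and \<open>{z, z'}\<close> over the non-adjacent pairs in \<open>N(u)\<close>; for \<open>Y = {}\<close>
  the first term is \<open>q E(V - u, {})\<close>. The non-adjacent pairs in \<open>N(u)\<close> form a
  triangle-free graph, hence number at most \<open>\<Delta>\<^sup>2 / 4\<close> by Mantel's theorem. For complex \<open>q\<close> with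
  \<open>\<bar>q\<bar> \<ge> 7/2 \<Delta>\<close> the two bounds
  \<open>\<bar>E(V, {})\<bar> \<ge> 9/14 \<bar>q\<bar> \<bar>E(V - v, {})\<bar>\<close> and \<open>\<bar>E(V, Y)\<bar> \<le> (7 / (2 \<bar>q\<bar>))\<^bsup>card Y - 1\<^esup> \<bar>E(V, {})\<bar>\<close>
  then reproduce themselves by induction on \<open>V\<close>, so that even \<open>7/2\<close> can replace \<open>3.81\<close>.
\<close>

section \<open>Finite counting\<close>

lemma sum_card_swap:
  assumes "finite A" "finite B"
  shows "(\<Sum>a\<in>A. card {b\<in>B. P a b}) = (\<Sum>b\<in>B. card {a\<in>A. P a b})"
  using assms by (simp only: card_eq_sum sum.inter_filter) (rule sum.swap)

lemma card_distinct_pairs: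
  assumes "finite M"
  shows "card {(a, b). a \<in> M \<and> b \<in> M \<and> a \<noteq> b} = card M * (card M - 1)"
proof -
  have "{(a, b). a \<in> M \<and> b \<in> M \<and> a \<noteq> b} = (SIGMA a:M. M - {a})"
    by auto
  then show ?thesis
    using assms by (simp add: card_SigmaI)
qed

text \<open>Delete both ends of an edge \<open>u w\<close>. By triangle-freeness each remaining
  vertex is adjacent to at most one of them, so with \<open>m = card W'\<close> at most
  \<open>m + 1\<close> edges are lost, and \<open>m^2 + 4 * m + 4 = (m + 2)^2\<close>. Pairs are
  ordered, so every edge counts twice and the bound is the usual \<open>n^2 / 4\<close> on
  edges.\<close>

lemma mantel:
  assumes "finite W"
    and sym: "\<And>a b. P a b \<Longrightarrow> P b a" and irrefl: "\<And>a. \<not> P a a"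
    and triangle_free: "\<And>a b c. a \<in> W \<Longrightarrow> b \<in> W \<Longrightarrow> c \<in> W \<Longrightarrow> P a b \<Longrightarrow> P b c \<Longrightarrow> \<not> P a c"
  shows "2 * card {(a, b). a \<in> W \<and> b \<in> W \<and> P a b} \<le> (card W)\<^sup>2"
  using assms(1,4)
proof (induction "card W" arbitrary: W rule: less_induct)
  case less
  define S where "S W = {(a, b). a \<in> W \<and> b \<in> W \<and> P a b}" for W
  have "2 * card (S W) \<le> (card W)\<^sup>2"
  proof (cases "S W = {}")
    case False
    then obtain u w where uw: "u \<in> W" "w \<in> W" "P u w" by (auto simp: S_def)
    then have ne: "u \<noteq> w" using irrefl by auto
    define W' where "W' = W - {u, w}"
    define A where "A = {a\<in>W'. P u a}"
    define B where "B = {b\<in>W'. P w b}"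
    have fin: "finite W'" "finite A" "finite B"
      using less.prems(1) by (auto simp: W'_def A_def B_def)
    have cW: "card W = card W' + 2"
      using uw ne less.prems(1) card_Diff_subset[of "{u, w}" W] card_mono[of W "{u, w}"]
      by (simp add: W'_def)
    have "A \<inter> B = {}"
      using less.prems(2)[of u w] uw by (auto simp: A_def B_def W'_def)
    then have "card A + card B = card (A \<union> B)"
      using fin by (simp add: card_Un_disjoint)
    also have "\<dots> \<le> card W'"
      using fin by (intro card_mono) (auto simp: A_def B_def)
    finally have AB: "card A + card B \<le> card W'" .
    have IH: "2 * card (S W') \<le> (card W')\<^sup>2"
      using less.prems unfolding S_def by (intro less.hyps) (auto simp: cW W'_def)
    have finS: "finite (S W')"
      by (rule finite_subset[of _ "W' \<times> W'"]) (use fin in \<open>auto simp: S_def\<close>)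
    have "S W \<subseteq> S W' \<union> ({(u, w), (w, u)} \<union>
        (({u} \<times> A \<union> A \<times> {u}) \<union> ({w} \<times> B \<union> B \<times> {w})))"
      using sym irrefl by (auto simp: S_def W'_def A_def B_def)
    then have "card (S W) \<le> card (S W' \<union> ({(u, w), (w, u)} \<union>
        (({u} \<times> A \<union> A \<times> {u}) \<union> ({w} \<times> B \<union> B \<times> {w}))))"
      using fin finS by (intro card_mono) auto
    also have "\<dots> \<le> card (S W') + (card {(u, w), (w, u)} +
        ((card ({u} \<times> A) + card (A \<times> {u})) + (card ({w} \<times> B) + card (B \<times> {w}))))"
      by (intro order.trans[OF card_Un_le] add_mono order.refl)
    also have "\<dots> \<le> card (S W') + (2 + 2 * (card A + card B))"
      using ne by (simp add: card_cartesian_product)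
    finally have "2 * card (S W) \<le> (card W')\<^sup>2 + 4 + 4 * card W'"
      using IH AB by (simp add: algebra_simps)
    then show ?thesis
      by (simp add: cW power2_eq_square algebra_simps)
  qed simp
  then show ?case unfolding S_def .
qed

section \<open>Colorings that are constant on a set\<close>

text \<open>Only the pairs of \<open>R\<close> inside \<open>V\<close> matter, so deleting a vertex
  changes \<open>V\<close> alone. The existential \<open>k\<close> lets an empty or singleton
  \<open>Y\<close> impose no condition.\<close>

definition colorings :: "'a rel \<Rightarrow> 'a set \<Rightarrow> 'a set \<Rightarrow> nat \<Rightarrow> ('a \<Rightarrow> nat) set" where
  "colorings R V Y q = {c \<in> V \<rightarrow>\<^sub>E {..<q}.
     (\<forall>(a, b) \<in> R. a \<in> V \<longrightarrow> b \<in> V \<longrightarrow> c a \<noteq> c b) \<and> (\<exists>k. \<forall>a\<in>Y. c a = k)}"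

lemma colorings_iff:
  "c \<in> colorings R V Y q \<longleftrightarrow> c \<in> V \<rightarrow>\<^sub>E {..<q} \<and>
     (\<forall>a b. (a, b) \<in> R \<longrightarrow> a \<in> V \<longrightarrow> b \<in> V \<longrightarrow> c a \<noteq> c b) \<and> (\<exists>k. \<forall>a\<in>Y. c a = k)"
  unfolding colorings_def by blast

lemma finite_colorings: "finite V \<Longrightarrow> finite (colorings R V Y q)"
  by (rule finite_subset[of _ "V \<rightarrow>\<^sub>E {..<q}"]) (auto simp: colorings_def intro: finite_PiE)

text \<open>Deletion-contraction read backwards: the colorings with \<open>c u = c y\<close> are all
  colorings minus those with \<open>c u \<noteq> c y\<close>, and the latter are the colorings after
  adding the edge \<open>(u, y)\<close>. Hence the induction on \<open>Y\<close> keeps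
  \<open>R\<close> arbitrary, and no vertices have to be merged.\<close>

lemma ex_poly_colorings:
  assumes "finite V" "Y \<subseteq> V" "irrefl R"
  shows "\<exists>p :: complex poly. \<forall>q. poly p (of_nat q) = of_nat (card (colorings R V Y q))"
proof -
  have "finite Y" using assms finite_subset by blast
  then show ?thesis
    using assms(2,3)
  proof (induction Y arbitrary: R rule: finite_induct)
    case empty
    have "colorings R V {} q = {c \<in> V \<rightarrow>\<^sub>E {..<q}. \<forall>(u, v) \<in> R \<inter> V \<times> V. c u \<noteq> c v}" for q
      by (auto simp: colorings_def)
    then show ?case
      using ex_coloring_poly[OF assms(1), of "R \<inter> V \<times> V"] empty.prems
      by (auto simp: irrefl_def)
  next
    case (insert u Y)
    obtain p :: "complex poly" where
      p: "\<And>q. poly p (of_nat q) = of_nat (card (colorings R V Y q))"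
      using insert.IH[of R] insert.prems by auto
    show ?case
    proof (cases "Y = {}")
      case True
      then have "colorings R V (insert u Y) q = colorings R V Y q" for q
        by (simp add: colorings_def)
      then show ?thesis using p by auto
    next
      case False
      then obtain y where y: "y \<in> Y" by auto
      define R' where "R' = insert (u, y) R"
      have "irrefl R'"
        using insert y by (auto simp: R'_def irrefl_def)
      then obtain p' :: "complex poly" where
        p': "\<And>q. poly p' (of_nat q) = of_nat (card (colorings R' V Y q))"
        using insert.IH[of R'] insert.prems by auto
      have "poly (p - p') (of_nat q) = of_nat (card (colorings R V (insert u Y) q))" for q
      proof -
        have same: "colorings R V (insert u Y) q = {c \<in> colorings R V Y q. c u = c y}"
          using y by (auto simp: colorings_iff)
        have diff: "colorings R' V Y q = {c \<in> colorings R V Y q. c u \<noteq> c y}"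
          using y insert.prems(1) by (auto simp: colorings_iff R'_def) blast
        have "colorings R V Y q = colorings R V (insert u Y) q \<union> colorings R' V Y q"
          "colorings R V (insert u Y) q \<inter> colorings R' V Y q = {}"
          unfolding same diff by auto
        then have "card (colorings R V Y q) =
            card (colorings R V (insert u Y) q) + card (colorings R' V Y q)"
          using card_Un_disjoint finite_colorings[OF assms(1)] by metis
        then show ?thesis by (simp add: p p')
      qed
      then show ?thesis by blast
    qed
  qed
qed

lemma poly_eqI_of_nat:
  fixes p p' :: "complex poly"
  assumes "\<And>q. q > 0 \<Longrightarrow> poly p (of_nat q) = poly p' (of_nat q)"
  shows "p = p'"
proof (rule ccontr)
  assume "p \<noteq> p'"
  then have "finite {x. poly (p - p') x = 0}"
    by (intro poly_roots_finite) simp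
  moreover have "of_nat ` {0<..} \<subseteq> {x. poly (p - p') x = 0}"
    using assms by auto
  ultimately have "finite (of_nat ` {0<..} :: complex set)"
    using finite_subset by blast
  then show False
    using infinite_Ioi[of "0 :: nat"] by (simp add: finite_image_iff inj_on_def)
qed

text \<open>This is \<open>E(V, Y)\<close> as a polynomial in \<open>q\<close>. For finite
  \<open>V\<close>, \<open>Y \<subseteq> V\<close> and irreflexive \<open>R\<close> it exists by
  \<open>ex_poly_colorings\<close>; uniqueness is \<open>poly_eqI_of_nat\<close>.\<close>

definition coloring_poly :: "'a rel \<Rightarrow> 'a set \<Rightarrow> 'a set \<Rightarrow> complex poly" where
  "coloring_poly R V Y = (THE p. \<forall>q. poly p (of_nat q) = of_nat (card (colorings R V Y q)))"

lemma poly_coloring_poly: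
  assumes "finite V" "Y \<subseteq> V" "irrefl R"
  shows "poly (coloring_poly R V Y) (of_nat q) = of_nat (card (colorings R V Y q))"
proof -
  obtain p :: "complex poly" where
    p: "\<forall>q. poly p (of_nat q) = of_nat (card (colorings R V Y q))"
    using ex_poly_colorings[OF assms] by auto
  have "coloring_poly R V Y = p"
    unfolding coloring_poly_def using p
    by (intro the_equality) (auto intro: poly_eqI_of_nat)
  then show ?thesis using p by simp
qed

text \<open>The relation \<open>Restr R (- {u})\<close> makes \<open>u\<close> an isolated vertex.\<close>

lemma card_colorings_isolated:
  assumes "u \<in> V" "Y \<subseteq> V - {u}" "Y \<noteq> {}"
  shows "card (colorings (Restr R (- {u})) V (insert u Y) q) = card (colorings R (V - {u}) Y q)"
proof -
  obtain y where y: "y \<in> Y" using assms by auto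
  have const: "(\<exists>k. \<forall>a\<in>Y. c a = k) \<longleftrightarrow> (\<forall>a\<in>Y. c a = c y)" for c :: "'a \<Rightarrow> nat"
    using y by auto
  have "bij_betw (\<lambda>c. restrict c (V - {u}))
      (colorings (Restr R (- {u})) V (insert u Y) q) (colorings R (V - {u}) Y q)"
  proof (rule bij_betw_byWitness[where f' = "\<lambda>c. c(u := c y)"])
    show "\<forall>c\<in>colorings (Restr R (- {u})) V (insert u Y) q.
        (restrict c (V - {u}))(u := restrict c (V - {u}) y) = c"
      using assms y by (auto simp: colorings_iff const fun_eq_iff PiE_def extensional_def)
    show "\<forall>c\<in>colorings R (V - {u}) Y q. restrict (c(u := c y)) (V - {u}) = c"
      by (auto simp: colorings_iff const fun_eq_iff PiE_def extensional_def)
    show "(\<lambda>c. restrict c (V - {u})) ` colorings (Restr R (- {u})) V (insert u Y) q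
        \<subseteq> colorings R (V - {u}) Y q"
      using assms(2) y by (auto simp: colorings_iff const PiE_def extensional_def Pi_def subset_iff)
    show "(\<lambda>c. c(u := c y)) ` colorings R (V - {u}) Y q
        \<subseteq> colorings (Restr R (- {u})) V (insert u Y) q"
    proof (rule image_subsetI)
      fix c assume c: "c \<in> colorings R (V - {u}) Y q"
      then have Y: "\<forall>a\<in>insert u Y. (c(u := c y)) a = c y"
        using y by (auto simp: colorings_iff)
      have "c y < q"
        using c y assms(2) by (auto simp: colorings_iff)
      then have PiE: "c(u := c y) \<in> V \<rightarrow>\<^sub>E {..<q}"
        using c assms(1) by (auto simp: colorings_iff PiE_def extensional_def Pi_def)
      have "(c(u := c y)) a \<noteq> (c(u := c y)) b"
        if "(a, b) \<in> Restr R (- {u})" "a \<in> V" "b \<in> V" for a b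
        using c that by (auto simp: colorings_iff)
      with Y PiE show "c(u := c y) \<in> colorings (Restr R (- {u})) V (insert u Y) q"
        unfolding colorings_iff by blast
    qed
  qed
  then show ?thesis by (rule bij_betw_same_card)
qed

text \<open>When no other vertex prescribes the color of the isolated \<open>u\<close>, that color
  is free, whence the factor \<open>q\<close>. The singleton \<open>{u}\<close> is
  \<open>insert u Y\<close> for empty \<open>Y\<close>, the form in which the recursion needs
  it.\<close>

lemma card_colorings_isolated_free:
  assumes "u \<in> V"
  shows "card (colorings (Restr R (- {u})) V {u} q) = q * card (colorings R (V - {u}) {} q)"
proof -
  have "bij_betw (\<lambda>c. (c u, restrict c (V - {u})))
      (colorings (Restr R (- {u})) V {u} q) ({..<q} \<times> colorings R (V - {u}) {} q)"
  proof (rule bij_betw_byWitness[where f' = "\<lambda>(k, c). c(u := k)"])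
    show "\<forall>c\<in>colorings (Restr R (- {u})) V {u} q.
        (case (c u, restrict c (V - {u})) of (k, c) \<Rightarrow> c(u := k)) = c"
      using assms by (auto simp: colorings_iff fun_eq_iff PiE_def extensional_def)
    show "\<forall>kc\<in>{..<q} \<times> colorings R (V - {u}) {} q.
        ((case kc of (k, c) \<Rightarrow> c(u := k)) u,
         restrict (case kc of (k, c) \<Rightarrow> c(u := k)) (V - {u})) = kc"
      by (auto simp: colorings_iff fun_eq_iff PiE_def extensional_def)
    show "(\<lambda>c. (c u, restrict c (V - {u}))) ` colorings (Restr R (- {u})) V {u} q
        \<subseteq> {..<q} \<times> colorings R (V - {u}) {} q"
      using assms by (auto simp: colorings_iff)
    show "(\<lambda>(k, c). c(u := k)) ` ({..<q} \<times> colorings R (V - {u}) {} q)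
        \<subseteq> colorings (Restr R (- {u})) V {u} q"
      using assms by (auto simp: colorings_iff PiE_def extensional_def Pi_def)
  qed
  then show ?thesis
    by (simp add: bij_betw_same_card card_cartesian_product)
qed

section \<open>Recursion in claw-free graphs\<close>

text \<open>The degree bound and the absence of claws concern all of \<open>R\<close> and so hold
  within every vertex set \<open>V\<close>. The induction can therefore shrink \<open>V\<close>
  while \<open>R\<close> and \<open>D\<close> stay fixed.\<close>

locale claw_free_rel =
  fixes R :: "'a rel" and D :: nat
  assumes sym: "sym R" and irrefl: "irrefl R"
    and finite_nbrs: "finite (R `` {v})" and degree: "card (R `` {v}) \<le> D"
    and no_claw: "\<lbrakk>(v, a) \<in> R; (v, b) \<in> R; (v, c) \<in> R; a \<noteq> b; a \<noteq> c; b \<noteq> c\<rbrakk>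
      \<Longrightarrow> (a, b) \<in> R \<or> (a, c) \<in> R \<or> (b, c) \<in> R"
begin

definition nbrs :: "'a set \<Rightarrow> 'a \<Rightarrow> 'a set" where
  "nbrs V u = R `` {u} \<inter> V"

text \<open>The pairs are ordered, so each non-adjacent pair occurs twice. This is why the recursion
  formulas below are multiplied by 2.\<close>

definition indep_pairs :: "'a set \<Rightarrow> 'a \<Rightarrow> ('a \<times> 'a) set" where
  "indep_pairs V u = {(a, b). a \<in> nbrs V u \<and> b \<in> nbrs V u \<and> a \<noteq> b \<and> (a, b) \<notin> R}"

lemma finite_nbrs_in: "finite (nbrs V u)"
  unfolding nbrs_def using finite_nbrs by blast

lemma card_nbrs_le: "card (nbrs V u) \<le> D"
  unfolding nbrs_def using card_mono[OF finite_nbrs, of "R `` {u} \<inter> V" u] degree[of u] by auto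

lemma nbrs_subset: "nbrs V u \<subseteq> V - {u}"
  using irrefl by (auto simp: nbrs_def irrefl_def)

lemma finite_indep_pairs: "finite (indep_pairs V u)"
  by (rule finite_subset[of _ "nbrs V u \<times> nbrs V u"])
    (auto simp: indep_pairs_def finite_nbrs_in)

text \<open>Three pairwise non-adjacent neighbours of \<open>u\<close> would form a claw centred at
  \<open>u\<close>, so Mantel's bound applies to non-adjacency on the neighbourhood.\<close>

lemma card_indep_pairs_le: "2 * card (indep_pairs V u) \<le> D\<^sup>2"
proof -
  have "2 * card (indep_pairs V u) \<le> (card (nbrs V u))\<^sup>2"
    unfolding indep_pairs_def
  proof (rule mantel[OF finite_nbrs_in])
    show "\<not> (a \<noteq> c \<and> (a, c) \<notin> R)"
      if "a \<in> nbrs V u" "b \<in> nbrs V u" "c \<in> nbrs V u" "a \<noteq> b \<and> (a, b) \<notin> R" "b \<noteq> c \<and> (b, c) \<notin> R"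
      for a b c
      using no_claw[of u a b c] that by (auto simp: nbrs_def)
  qed (use sym in \<open>auto simp: sym_def\<close>)
  also have "\<dots> \<le> D\<^sup>2"
    using card_nbrs_le by (simp add: power_mono)
  finally show ?thesis .
qed

text \<open>
  A color occurs \<open>m \<le> 2\<close> times in the neighbourhood of \<open>u\<close>, so that the indicator of \<open>m = 0\<close>
  is the truncated inclusion-exclusion sum \<open>1 - m + m (m - 1) / 2\<close>.
\<close>

lemma card_colorings_insert:
  assumes V: "finite V" "u \<in> V" and Y: "Y \<subseteq> V - {u}"
  shows "2 * card (colorings R V (insert u Y) q)
      + 2 * (\<Sum>z\<in>nbrs V u. card (colorings R (V - {u}) (insert z Y) q))
    = 2 * card (colorings (Restr R (- {u})) V (insert u Y) q)
      + (\<Sum>(z, z')\<in>indep_pairs V u. card (colorings R (V - {u}) (insert z (insert z' Y)) q))"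
proof -
  \<comment> \<open>All four terms of the identity count elements of \<open>C\<close>, where
    \<open>u\<close> is isolated and shares the color of \<open>Y\<close>, or sum such counts.
    \<open>M c\<close> collects the neighbours of \<open>u\<close> that clash with it.\<close>
  define C where "C = colorings (Restr R (- {u})) V (insert u Y) q"
  have finC: "finite C"
    unfolding C_def using V(1) by (rule finite_colorings)
  define M where "M c = {z\<in>nbrs V u. c z = c u}" for c :: "'a \<Rightarrow> nat"
  have finM: "finite (M c)" for c
    unfolding M_def using finite_nbrs_in by simp
  \<comment> \<open>Members of \<open>M c\<close> have equal colors and differ from
    \<open>u\<close>, so an edge between them would survive the isolation of \<open>u\<close> and
    violate properness. Three of them would then be the leaves of a claw at
    \<open>u\<close>.\<close>
  have indep: "(a, b) \<notin> R" if "c \<in> C" "a \<in> M c" "b \<in> M c" for a b c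
  proof
    assume "(a, b) \<in> R"
    moreover have "a \<in> V - {u}" "b \<in> V - {u}" "c a = c b"
      using that(2,3) nbrs_subset by (auto simp: M_def)
    ultimately show False
      using that(1) unfolding C_def colorings_iff by blast
  qed
  have le2: "card (M c) \<le> 2" if "c \<in> C" for c
  proof (rule ccontr)
    assume "\<not> card (M c) \<le> 2"
    then have "3 \<le> card (M c)" by simp
    then obtain T where T: "T \<subseteq> M c" "card T = 3"
      by (meson obtain_subset_with_card_n)
    then obtain x y z where xyz: "T = {x, y, z}" "x \<noteq> y" "x \<noteq> z" "y \<noteq> z"
      by (auto simp: card_3_iff)
    then have M: "x \<in> M c" "y \<in> M c" "z \<in> M c" using T by auto
    then have "(u, x) \<in> R" "(u, y) \<in> R" "(u, z) \<in> R"
      by (auto simp: M_def nbrs_def)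
    then show False
      using no_claw xyz(2-) indep[OF that] M by blast
  qed
  \<comment> \<open>The subtraction on naturals is harmless: for \<open>card (M c) = 0\<close> its
    cofactor vanishes.\<close>
  have trunc: "2 * of_bool (M c = {}) + 2 * card (M c) = 2 + card (M c) * (card (M c) - 1)"
    if c: "c \<in> C" for c
  proof -
    consider "card (M c) = 0" | "card (M c) = 1" | "card (M c) = 2"
      using le2[OF c] by linarith
    then show ?thesis
      using finM[of c] by cases auto
  qed
  have nbr: "{c\<in>C. c z = c u} = colorings (Restr R (- {u})) V (insert u (insert z Y)) q" for z
    unfolding C_def by (auto simp: colorings_iff)
  \<comment> \<open>Restoring the edges at \<open>u\<close> keeps exactly those colorings of
    \<open>C\<close> in which no neighbour of \<open>u\<close> has its color.\<close>
  have 1: "colorings R V (insert u Y) q = {c\<in>C. M c = {}}"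
    using V(2) sym unfolding C_def M_def
    by (auto simp: colorings_iff nbrs_def sym_def) metis+
  have 2: "card (colorings R (V - {u}) (insert z Y) q) = card {c\<in>C. c z = c u}"
    if "z \<in> nbrs V u" for z
    unfolding nbr using that nbrs_subset V Y
    by (subst card_colorings_isolated) auto
  have 3: "card (colorings R (V - {u}) (insert z (insert z' Y)) q) =
      card {c\<in>C. c z = c u \<and> c z' = c u}" if "(z, z') \<in> indep_pairs V u" for z z'
  proof -
    have "{c\<in>C. c z = c u \<and> c z' = c u} =
        colorings (Restr R (- {u})) V (insert u (insert z (insert z' Y))) q"
      unfolding C_def by (auto simp: colorings_iff)
    then show ?thesis
      using that nbrs_subset V Y unfolding indep_pairs_def
      by (subst card_colorings_isolated[symmetric]) auto
  qed
  have pairs: "{p\<in>indep_pairs V u. c (fst p) = c u \<and> c (snd p) = c u} =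
      {(a, b). a \<in> M c \<and> b \<in> M c \<and> a \<noteq> b}" if "c \<in> C" for c
    using indep[OF that] by (auto simp: indep_pairs_def M_def)
  have "2 * card (colorings R V (insert u Y) q)
      + 2 * (\<Sum>z\<in>nbrs V u. card (colorings R (V - {u}) (insert z Y) q))
    = 2 * card {c\<in>C. M c = {}} + 2 * (\<Sum>z\<in>nbrs V u. card {c\<in>C. c z = c u})"
    using 1 2 by simp
  also have "\<dots> = 2 * (\<Sum>c\<in>C. of_bool (M c = {})) + 2 * (\<Sum>c\<in>C. card (M c))"
    using finC finite_nbrs_in by (subst sum_card_swap) (auto simp: M_def sum_of_bool_eq Int_def)
  also have "\<dots> = (\<Sum>c\<in>C. 2 * of_bool (M c = {}) + 2 * card (M c))"
    by (simp add: sum.distrib sum_distrib_left)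
  also have "\<dots> = (\<Sum>c\<in>C. 2 + card (M c) * (card (M c) - 1))"
    using trunc by (intro sum.cong) auto
  also have "\<dots> = 2 * card C +
      (\<Sum>c\<in>C. card {p\<in>indep_pairs V u. c (fst p) = c u \<and> c (snd p) = c u})"
    using pairs finM by (subst sum.distrib) (simp add: card_distinct_pairs)
  also have "\<dots> = 2 * card C +
      (\<Sum>p\<in>indep_pairs V u. card {c\<in>C. c (fst p) = c u \<and> c (snd p) = c u})"
    using finC finite_indep_pairs by (subst sum_card_swap) auto
  also have "\<dots> = 2 * card C +
      (\<Sum>(z, z')\<in>indep_pairs V u. card (colorings R (V - {u}) (insert z (insert z' Y)) q))"
    using 3 by (intro arg_cong2[where f = "(+)"] sum.cong) auto
  finally show ?thesis unfolding C_def .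
qed

section \<open>Recursion and bounds at complex arguments\<close>

definition val :: "complex \<Rightarrow> 'a set \<Rightarrow> 'a set \<Rightarrow> complex" where
  "val x V Y = poly (coloring_poly R V Y) x"

text \<open>The counting identity holds at all positive integers, hence between polynomials, hence
  at \<open>x\<close>. The polynomial \<open>p\<close> for the isolated \<open>u\<close> is left
  open because it is \<open>E(V - u, Y)\<close> for nonempty \<open>Y\<close> but
  \<open>q E(V - u, {})\<close> for empty \<open>Y\<close>.\<close>

lemma val_insert_aux:
  assumes V: "finite V" "u \<in> V" and Y: "Y \<subseteq> V - {u}"
    and p: "\<And>q. poly p (of_nat q) = of_nat (card (colorings (Restr R (- {u})) V (insert u Y) q))"
  shows "2 * val x V (insert u Y) + 2 * (\<Sum>z\<in>nbrs V u. val x (V - {u}) (insert z Y))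
    = 2 * poly p x + (\<Sum>(z, z')\<in>indep_pairs V u. val x (V - {u}) (insert z (insert z' Y)))"
proof -
  have *: "poly (coloring_poly R W Z) (of_nat q) = of_nat (card (colorings R W Z q))"
    if "W \<subseteq> V" "Z \<subseteq> W" for W Z q
    by (rule poly_coloring_poly[OF finite_subset[OF that(1) V(1)] that(2) irrefl])
  have "2 * coloring_poly R V (insert u Y)
      + 2 * (\<Sum>z\<in>nbrs V u. coloring_poly R (V - {u}) (insert z Y))
    = 2 * p + (\<Sum>(z, z')\<in>indep_pairs V u. coloring_poly R (V - {u}) (insert z (insert z' Y)))"
    (is "?l = ?r")
  proof (rule poly_eqI_of_nat)
    fix q
    have a: "(\<Sum>z\<in>nbrs V u. poly (coloring_poly R (V - {u}) (insert z Y)) (of_nat q))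
        = of_nat (\<Sum>z\<in>nbrs V u. card (colorings R (V - {u}) (insert z Y) q))"
      unfolding of_nat_sum using nbrs_subset Y by (intro sum.cong *) auto
    have b: "(\<Sum>(z, z')\<in>indep_pairs V u.
          poly (coloring_poly R (V - {u}) (insert z (insert z' Y))) (of_nat q))
        = of_nat (\<Sum>(z, z')\<in>indep_pairs V u.
          card (colorings R (V - {u}) (insert z (insert z' Y)) q))"
      unfolding of_nat_sum using nbrs_subset Y
      by (intro sum.cong) (auto simp: indep_pairs_def intro!: *)
    have "poly ?l (of_nat q) = of_nat (2 * card (colorings R V (insert u Y) q)
      + 2 * (\<Sum>z\<in>nbrs V u. card (colorings R (V - {u}) (insert z Y) q)))"
      using V Y by (subst of_nat_add) (simp add: poly_sum a * subset_iff)
    also have "\<dots> = of_nat (2 * card (colorings (Restr R (- {u})) V (insert u Y) q)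
      + (\<Sum>(z, z')\<in>indep_pairs V u. card (colorings R (V - {u}) (insert z (insert z' Y)) q)))"
      using card_colorings_insert[OF V Y] by simp
    also have "\<dots> = poly ?r (of_nat q)"
      using b by (subst of_nat_add) (simp add: poly_sum p case_prod_unfold)
    finally show "poly ?l (of_nat q) = poly ?r (of_nat q)" .
  qed
  then have "poly ?l x = poly ?r x" by simp
  then show ?thesis
    by (simp add: val_def poly_sum case_prod_unfold)
qed

lemma val_singleton: "val x V {u} = val x V {}"
proof -
  have "colorings R V {u} = colorings R V {}"
    by (auto simp: colorings_def fun_eq_iff)
  then show ?thesis by (simp add: val_def coloring_poly_def)
qed

lemma val_insert:
  assumes "finite V" "u \<in> V" "Y \<subseteq> V - {u}" "Y \<noteq> {}"
  shows "2 * val x V (insert u Y) = 2 * val x (V - {u}) Y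
    - 2 * (\<Sum>z\<in>nbrs V u. val x (V - {u}) (insert z Y))
    + (\<Sum>(z, z')\<in>indep_pairs V u. val x (V - {u}) (insert z (insert z' Y)))"
proof -
  have "poly (coloring_poly R (V - {u}) Y) (of_nat q) =
      of_nat (card (colorings (Restr R (- {u})) V (insert u Y) q))" for q
    using card_colorings_isolated[OF assms(2-4)] poly_coloring_poly[of "V - {u}" Y R] assms irrefl
    by simp
  from val_insert_aux[OF assms(1-3) this] show ?thesis
    by (simp add: val_def algebra_simps)
qed

text \<open>The isolated vertex contributes the factor \<open>x\<close>. Each neighbour
  \<open>z\<close> contributes \<open>E(V - u, {z})\<close>, which equals
  \<open>E(V - u, {})\<close>; together they turn \<open>x\<close> into \<open>x\<close> minus the
  degree of \<open>u\<close> in \<open>V\<close>.\<close>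

lemma val_empty:
  assumes "finite V" "u \<in> V"
  shows "2 * val x V {} = 2 * (x - of_nat (card (nbrs V u))) * val x (V - {u}) {}
    + (\<Sum>(z, z')\<in>indep_pairs V u. val x (V - {u}) {z, z'})"
proof -
  have "poly ([:0, 1:] * coloring_poly R (V - {u}) {}) (of_nat q) =
      of_nat (card (colorings (Restr R (- {u})) V (insert u {}) q))" for q
    using card_colorings_isolated_free[OF assms(2)] poly_coloring_poly[of "V - {u}" "{}" R] assms irrefl
    by simp
  from val_insert_aux[OF assms(1,2) _ this] show ?thesis
    by (simp add: val_singleton) (simp add: val_def algebra_simps)
qed

lemma val_eq_0:
  assumes "Y \<subseteq> V" "a \<in> Y" "b \<in> Y" "(a, b) \<in> R"
  shows "val x V Y = 0"
proof -
  have "c \<notin> colorings R V Y q" for c q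
    using assms unfolding colorings_iff by (metis subsetD)
  then have "colorings R V Y q = {}" for q
    by blast
  then have "coloring_poly R V Y = 0"
    unfolding coloring_poly_def by (intro the_equality) (auto intro: poly_eqI_of_nat)
  then show ?thesis by (simp add: val_def)
qed

lemma val_empty_empty: "val x {} {} = 1"
proof -
  have "colorings R {} {} q = {\<lambda>_. undefined}" for q
    by (auto simp: colorings_iff)
  then have "coloring_poly R {} {} = 1"
    unfolding coloring_poly_def by (intro the_equality) (auto intro: poly_eqI_of_nat)
  then show ?thesis by (simp add: val_def)
qed

text \<open>The constant arises as follows. Let \<open>Q = cmod x\<close>,
  \<open>Q \<ge> c D\<close> and \<open>g = c / Q\<close>, so that \<open>D g \<le> 1\<close>. The
  recursion for empty \<open>Y\<close> leaves the factor
  \<open>Q - D - D / 4 \<ge> (1 - 5 / (4 c)) Q\<close>, and the one for nonempty \<open>Y\<close>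
  costs \<open>1 + 1 + 1 / 4 = 9 / 4\<close>. The bounds reproduce if
  \<open>9 / 4 \<le> g (1 - 5 / (4 c)) Q = c - 5 / 4\<close>, that is, \<open>c \<ge> 7 / 2\<close>;
  then \<open>1 - 5 / (4 c)\<close> is \<open>9 / 14\<close> at \<open>c = 7 / 2\<close>.\<close>

lemma val_bounds:
  fixes x :: complex
  assumes "finite V" and x: "x \<noteq> 0" "7 / 2 * real D \<le> cmod x"
  shows "val x V {} \<noteq> 0"
    and "\<And>v. v \<in> V \<Longrightarrow> 9 / 14 * cmod x * cmod (val x (V - {v}) {}) \<le> cmod (val x V {})"
    and "\<And>Y. Y \<subseteq> V \<Longrightarrow> Y \<noteq> {} \<Longrightarrow>
      cmod (val x V Y) \<le> (7 / (2 * cmod x)) ^ (card Y - 1) * cmod (val x V {})"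
proof -
  define Q where "Q = cmod x"
  define g where "g = 7 / (2 * Q)"
  have Q: "Q > 0" "7 / 2 * real D \<le> Q"
    using x by (auto simp: Q_def)
  have g: "g > 0" using Q by (simp add: g_def)
  have Dg: "real D * g \<le> 1" using Q by (simp add: g_def field_simps)
  have pairs: "real (card (indep_pairs W u)) \<le> (real D)\<^sup>2 / 2" for W u
    using of_nat_mono[OF card_indep_pairs_le[of W u], where 'a = real] by simp
  have pair_sum: "cmod (\<Sum>(z, z')\<in>indep_pairs W u. h z z') \<le> (real D)\<^sup>2 / 2 * B"
    if "\<And>z z'. (z, z') \<in> indep_pairs W u \<Longrightarrow> cmod (h z z') \<le> B" "0 \<le> B" for W u h B
  proof -
    have "cmod (\<Sum>(z, z')\<in>indep_pairs W u. h z z') \<le> of_nat (card (indep_pairs W u)) * B"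
      using that(1) by (intro sum_norm_bound) auto
    also have "\<dots> \<le> (real D)\<^sup>2 / 2 * B"
      using pairs that(2) by (intro mult_right_mono) auto
    finally show ?thesis .
  qed
  have "val x V {} \<noteq> 0 \<and>
    (\<forall>v\<in>V. 9 / 14 * Q * cmod (val x (V - {v}) {}) \<le> cmod (val x V {})) \<and>
    (\<forall>Y. Y \<subseteq> V \<longrightarrow> Y \<noteq> {} \<longrightarrow> cmod (val x V Y) \<le> g ^ (card Y - 1) * cmod (val x V {}))"
    using assms(1)
  proof (induction "card V" arbitrary: V rule: less_induct)
    case less
    have IH: "val x (V - {v}) {} \<noteq> 0"
      "\<And>Y. Y \<subseteq> V - {v} \<Longrightarrow> Y \<noteq> {} \<Longrightarrow>
        cmod (val x (V - {v}) Y) \<le> g ^ (card Y - 1) * cmod (val x (V - {v}) {})"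
      if "v \<in> V" for v
      using less.hyps[of "V - {v}"] less.prems card_Diff1_less[OF less.prems that] by auto
    \<comment> \<open>The deletion bound for \<open>V\<close> comes from \<open>val_empty\<close>,
      with the third claim for \<open>V - {v}\<close> applied to two-element sets.\<close>
    have step: "9 / 14 * Q * cmod (val x (V - {v}) {}) \<le> cmod (val x V {})" if v: "v \<in> V" for v
    proof -
      define E where "E = cmod (val x (V - {v}) {})"
      have E: "E \<ge> 0" by (simp add: E_def)
      let ?d = "real (card (nbrs V v))"
      let ?S = "\<Sum>(z, z')\<in>indep_pairs V v. val x (V - {v}) {z, z'}"
      have d: "?d \<le> 2 / 7 * Q"
        using of_nat_mono[OF card_nbrs_le[of V v], where 'a = real] Q by linarith
      have "cmod ?S \<le> (real D)\<^sup>2 / 2 * (g * E)"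
      proof (rule pair_sum)
        fix z z' assume p: "(z, z') \<in> indep_pairs V v"
        then have "{z, z'} \<subseteq> V - {v}" "card {z, z'} = 2"
          using nbrs_subset[of V v] by (auto simp: indep_pairs_def)
        then show "cmod (val x (V - {v}) {z, z'}) \<le> g * E"
          using IH(2)[OF v, of "{z, z'}"] by (simp add: E_def)
      qed (use g E in auto)
      \<comment> \<open>Of the two factors \<open>D\<close>, one is absorbed by \<open>g\<close> and
        the other by \<open>D \<le> 2 / 7 * Q\<close>.\<close>
      also have "\<dots> = real D * g * (real D * E / 2)"
        by (simp add: power2_eq_square)
      also have "\<dots> \<le> 1 * (real D * E / 2)"
        using Dg E by (intro mult_right_mono) auto
      also have "\<dots> \<le> 1 / 7 * Q * E"
        using mult_right_mono[OF Q(2) E] by simp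
      finally have S: "cmod ?S \<le> 1 / 7 * Q * E" .
      have "2 * ((Q - ?d) * E) \<le> 2 * (cmod (x - of_nat (card (nbrs V v))) * E)"
        using norm_triangle_ineq2[of x "of_nat (card (nbrs V v))"] E
        by (intro mult_left_mono mult_right_mono) (auto simp: Q_def)
      also have "\<dots> = cmod (2 * ((x - of_nat (card (nbrs V v))) * val x (V - {v}) {}))"
        unfolding norm_mult E_def by simp
      also have "\<dots> = cmod (2 * val x V {} - ?S)"
        using val_empty[OF less.prems v, of x]
        by (intro arg_cong[where f = cmod]) (simp add: algebra_simps)
      also have "\<dots> \<le> 2 * cmod (val x V {}) + cmod ?S"
        using norm_triangle_ineq4[of "2 * val x V {}" ?S] by (simp add: norm_mult)
      finally have "2 * ((Q - ?d) * E) \<le> 2 * cmod (val x V {}) + 1 / 7 * Q * E"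
        using S by linarith
      \<comment> \<open>The left side above is thus at least \<open>10 / 7 * Q * E\<close>. Taking
        off \<open>1 / 7 * Q * E\<close> leaves \<open>9 / 7\<close>, twice the claimed
        \<open>9 / 14\<close>.\<close>
      moreover have "5 / 7 * Q * E \<le> (Q - ?d) * E"
        using d E by (intro mult_right_mono) auto
      ultimately show ?thesis
        unfolding E_def by linarith
    qed
    have nz: "val x V {} \<noteq> 0"
    proof (cases "V = {}")
      case False
      then obtain v where v: "v \<in> V" by auto
      have "0 < 9 / 14 * Q * cmod (val x (V - {v}) {})"
        using IH(1)[OF v] Q by simp
      then show ?thesis using step[OF v] by auto
    qed (simp add: val_empty_empty)
    have "cmod (val x V Y) \<le> g ^ (card Y - 1) * cmod (val x V {})" if Y: "Y \<subseteq> V" "Y \<noteq> {}" for Y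
    proof -
      have finY: "finite Y" using Y less.prems finite_subset by blast
      obtain u where u: "u \<in> Y" using Y by auto
      define Y' where "Y' = Y - {u}"
      have uY: "Y = insert u Y'" "Y' \<subseteq> V - {u}" "u \<in> V" "finite Y'" "u \<notin> Y'"
        using u Y finY by (auto simp: Y'_def)
      \<comment> \<open>If \<open>Y\<close> contains an edge, the value is 0. Otherwise the
        neighbours of \<open>u\<close> lie outside \<open>Y'\<close>, so inserting one or two of
        them raises the cardinality by exactly that much and gains as many powers of
        \<open>g\<close>.\<close>
      consider "Y' = {}" | a b where "a \<in> Y" "b \<in> Y" "(a, b) \<in> R"
        | "Y' \<noteq> {}" "\<And>a b. a \<in> Y \<Longrightarrow> b \<in> Y \<Longrightarrow> (a, b) \<notin> R"
        by blast
      then show ?thesis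
      proof cases
        case 1
        then show ?thesis using uY by (simp add: val_singleton)
      next
        case 2
        then show ?thesis using val_eq_0[OF Y(1)] g by simp
      next
        case 3
        define E where "E = cmod (val x (V - {u}) {})"
        have E: "E \<ge> 0" by (simp add: E_def)
        obtain k where k: "card Y' = Suc k"
          using 3 uY(4) by (metis card_eq_0_iff not0_implies_Suc)
        have disj: "nbrs V u \<inter> Y' = {}"
          using 3(2)[OF u] uY by (auto simp: nbrs_def)
        let ?N = "\<Sum>z\<in>nbrs V u. val x (V - {u}) (insert z Y')"
        let ?S = "\<Sum>(z, z')\<in>indep_pairs V u. val x (V - {u}) (insert z (insert z' Y'))"
        have "cmod ?N \<le> of_nat (card (nbrs V u)) * (g ^ Suc k * E)"
        proof (rule sum_norm_bound)
          fix z assume z: "z \<in> nbrs V u"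
          then have "card (insert z Y') = Suc (Suc k)"
            using k disj uY(4) by (subst card_insert_disjoint) auto
          then show "cmod (val x (V - {u}) (insert z Y')) \<le> g ^ Suc k * E"
            using IH(2)[OF uY(3), of "insert z Y'"] uY z nbrs_subset[of V u]
            by (simp add: E_def subset_iff)
        qed
        also have "\<dots> \<le> real D * (g ^ Suc k * E)"
          using card_nbrs_le g E by (intro mult_right_mono) auto
        also have "\<dots> = (real D * g) * (g ^ k * E)"
          by simp
        also have "\<dots> \<le> 1 * (g ^ k * E)"
          using Dg g E by (intro mult_right_mono) auto
        finally have N: "cmod ?N \<le> g ^ k * E" by simp
        have "cmod ?S \<le> (real D)\<^sup>2 / 2 * (g ^ Suc (Suc k) * E)"
        proof (rule pair_sum)
          fix z z' assume p: "(z, z') \<in> indep_pairs V u"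
          then have zz: "z \<in> nbrs V u" "z' \<in> nbrs V u" "z \<noteq> z'"
            by (auto simp: indep_pairs_def)
          then have "card (insert z (insert z' Y')) = Suc (Suc (Suc k))"
            using k disj uY(4) by (auto simp: card_insert_if)
          then show "cmod (val x (V - {u}) (insert z (insert z' Y'))) \<le> g ^ Suc (Suc k) * E"
            using IH(2)[OF uY(3), of "insert z (insert z' Y')"] uY zz nbrs_subset[of V u]
            by (simp add: E_def subset_iff)
        qed (use g E in auto)
        also have "\<dots> = (real D * g)\<^sup>2 * (g ^ k * E / 2)"
          by (simp add: power2_eq_square)
        also have "\<dots> \<le> 1 * (g ^ k * E / 2)"
          using Dg g E by (intro mult_right_mono power_le_one) auto
        finally have S: "cmod ?S \<le> g ^ k * E / 2" by simp
        have M: "cmod (val x (V - {u}) Y') \<le> g ^ k * E"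
          using IH(2)[OF uY(3,2) 3(1)] k by (simp add: E_def)
        have "2 * cmod (val x V Y) = cmod (2 * val x V Y)"
          by (simp add: norm_mult)
        also have "\<dots> = cmod (2 * val x (V - {u}) Y' - 2 * ?N + ?S)"
          unfolding uY(1) using val_insert[OF less.prems uY(3,2) 3(1)] by simp
        also have "\<dots> \<le> cmod (2 * val x (V - {u}) Y') + cmod (2 * ?N) + cmod ?S"
          by (intro order.trans[OF norm_triangle_ineq] add_mono norm_triangle_ineq4 order.refl)
        \<comment> \<open>Here \<open>9 / 2 = 2 + 2 + 1 / 2\<close>. As
          \<open>g * Q = 7 / 2\<close>, this is also \<open>2 * g * (9 / 14 * Q)\<close>, so the
          deletion bound closes the induction with no slack.\<close>
        also have "\<dots> \<le> 9 / 2 * (g ^ k * E)"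
          using M N S by (simp add: norm_mult)
        also have "\<dots> = 2 * g ^ Suc k * (9 / 14 * Q * E)"
          using Q by (simp add: g_def)
        also have "\<dots> \<le> 2 * g ^ Suc k * cmod (val x V {})"
          using step[OF uY(3)] g unfolding E_def by (intro mult_left_mono) auto
        finally show ?thesis
          using k uY by simp
      qed
    qed
    then show ?case using nz step by blast
  qed
  then show "val x V {} \<noteq> 0"
    and "\<And>v. v \<in> V \<Longrightarrow> 9 / 14 * cmod x * cmod (val x (V - {v}) {}) \<le> cmod (val x V {})"
    and "\<And>Y. Y \<subseteq> V \<Longrightarrow> Y \<noteq> {} \<Longrightarrow>
      cmod (val x V Y) \<le> (7 / (2 * cmod x)) ^ (card Y - 1) * cmod (val x V {})"
    by (simp_all add: g_def Q_def)
qed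

end

section \<open>Claw-free digraphs\<close>

lemma card_nbrs_le_max_degree:
  assumes "graph G"
  shows "finite (arcs_ends G `` {v})" and "card (arcs_ends G `` {v}) \<le> max_degree G"
proof -
  interpret graph G by fact
  have eq: "arcs_ends G `` {v} = head G ` out_arcs G v"
    by (auto simp: arcs_ends_conv out_arcs_def)
  have fin: "finite (out_arcs G v)"
    by (rule finite_subset[OF _ finite_arcs]) (auto simp: out_arcs_def)
  then show "finite (arcs_ends G `` {v})" by (simp add: eq)
  have "card (arcs_ends G `` {v}) \<le> out_degree G v"
    unfolding eq out_degree_def using fin by (rule card_image_le)
  also have "\<dots> \<le> max_degree G"
  proof (cases "v \<in> verts G")
    \<comment> \<open>The locale asks for the degree bound at every element of the type; outside the
      vertex set there are no arcs.\<close>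
    case False
    then have "out_arcs G v = {}" by (auto simp: out_arcs_def)
    then show ?thesis by (simp add: out_degree_def)
  qed (simp add: max_degree_def)
  finally show "card (arcs_ends G `` {v}) \<le> max_degree G" .
qed

text \<open>The right side is the arc set that \<open>complete_bipartite_digraph\<close> prescribes
  for the parts \<open>{v}\<close> and \<open>{a, b, c}\<close>. Stating this for a bare relation
  keeps the case analysis over pairs free of digraphs.\<close>

lemma Restr_claw:
  assumes sym: "\<And>x y. (x, y) \<in> E \<Longrightarrow> (y, x) \<in> E" and irr: "\<And>x. (x, x) \<notin> E"
    and "(v, a) \<in> E" "(v, b) \<in> E" "(v, c) \<in> E" "(a, b) \<notin> E" "(a, c) \<notin> E" "(b, c) \<notin> E"
  shows "Restr E {v, a, b, c} = {v} \<times> {a, b, c} \<union> {a, b, c} \<times> {v}"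
proof -
  have "(a, v) \<in> E" "(b, v) \<in> E" "(c, v) \<in> E" "(b, a) \<notin> E" "(c, a) \<notin> E" "(c, b) \<notin> E"
    using assms by blast+
  note edges = this assms(2-)
  have "x = v \<and> y \<in> {a, b, c} \<or> x \<in> {a, b, c} \<and> y = v"
    if "(x, y) \<in> E" "x \<in> {v, a, b, c}" "y \<in> {v, a, b, c}" for x y
    using that(2,3,1) edges by (elim insertE emptyE) simp_all
  moreover have "{v} \<times> {a, b, c} \<union> {a, b, c} \<times> {v} \<subseteq> Restr E {v, a, b, c}"
    using edges by simp
  ultimately show ?thesis by blast
qed

text \<open>Otherwise the subgraph induced on \<open>v\<close>, \<open>a\<close>, \<open>b\<close>,
  \<open>c\<close> is a complete bipartite digraph with parts of sizes 1 and 3.\<close>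

lemma claw_free_no_claw:
  assumes "graph G" "claw_free G"
    and edges: "(v, a) \<in> arcs_ends G" "(v, b) \<in> arcs_ends G" "(v, c) \<in> arcs_ends G"
    and ne: "a \<noteq> b" "a \<noteq> c" "b \<noteq> c"
  shows "(a, b) \<in> arcs_ends G \<or> (a, c) \<in> arcs_ends G \<or> (b, c) \<in> arcs_ends G"
proof (rule ccontr)
  assume nadj: "\<not> ?thesis"
  interpret graph G by fact
  note sym = graph_symmetric
  have irr: "(x, x) \<notin> arcs_ends G" for x
    using no_loops by (auto simp: arcs_ends_conv)
  define W where "W = {v, a, b, c}"
  let ?H = "G \<restriction> W"
  have WV: "W \<subseteq> verts G"
    using edges by (auto simp: W_def arcs_ends_conv)
  have ind: "induced_subgraph ?H G"
    using WV by (rule induced_induce)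
  have ends: "arcs_ends ?H = arcs_ends G \<inter> W \<times> W"
    by (auto simp: arcs_ends_conv)
  have "arcs_ends ?H = {v} \<times> {a, b, c} \<union> {a, b, c} \<times> {v}"
    unfolding ends unfolding W_def by (rule Restr_claw[OF sym irr edges]) (use nadj in simp_all)
  moreover have "verts ?H = {v} \<union> {a, b, c}" "{v} \<inter> {a, b, c} = {}"
    "card {v} = 1" "card {a, b, c} = 3"
    using edges irr ne by (auto simp: W_def)
  moreover have "graph ?H"
  proof
    show "symmetric ?H"
      unfolding symmetric_def ends using sym by (intro symI) blast
    show "finite (verts ?H)" by (simp add: W_def)
    show "e1 = e2" if "e1 \<in> arcs ?H" "e2 \<in> arcs ?H" "arc_to_ends ?H e1 = arc_to_ends ?H e2" for e1 e2
      using that no_multi_arcs by (auto simp: arc_to_ends_def)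
  qed (auto simp: no_loops)
  ultimately have "complete_bipartite_digraph 1 3 ?H"
    unfolding complete_bipartite_digraph_def by blast
  with ind assms(2) show False
    unfolding claw_free_def by blast
qed

theorem theorem1p3:
  fixes G :: "('a, 'b) pre_digraph" and z :: complex
  assumes "graph G"
    and "claw_free G"
    and "poly (chromatic_poly G) z = 0"
  shows "cmod z \<le> 3.81 * real (max_degree G)"
proof (rule ccontr)
  assume "\<not> ?thesis"
  \<comment> \<open>The negated bound is strict, which excludes \<open>z = 0\<close> even for
    maximum degree 0, and \<open>3.81\<close> exceeds \<open>7 / 2\<close>.\<close>
  then have z: "z \<noteq> 0" "7 / 2 * real (max_degree G) \<le> cmod z"
    by auto
  interpret graph G by fact
  interpret claw_free_rel "arcs_ends G" "max_degree G"
  proof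
    show "sym (arcs_ends G)"
      using sym_arcs by (simp add: symmetric_def)
    show "irrefl (arcs_ends G)"
      using no_loops by (auto simp: arcs_ends_conv irrefl_def)
  qed (fact card_nbrs_le_max_degree[OF assms(1)] claw_free_no_claw[OF assms(1,2)])+
  \<comment> \<open>Every arc has both ends in \<open>verts G\<close> and constancy on
    \<open>{}\<close> is void, so \<open>E(V, {})\<close> for the full vertex set is the chromatic
    polynomial.\<close>
  have "proper_colorings q G = colorings (arcs_ends G) (verts G) {} q" for q
    by (auto simp: proper_colorings_def colorings_def arcs_ends_conv)
  then have "poly (chromatic_poly G) (of_nat q) =
      poly (coloring_poly (arcs_ends G) (verts G) {}) (of_nat q)" if "q > 0" for q
    using is_chromatic_poly_chromatic_poly[OF assms(1)] that poly_coloring_poly[OF finite_verts _ irrefl]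
    by (simp add: is_chromatic_poly_def)
  then have "chromatic_poly G = coloring_poly (arcs_ends G) (verts G) {}"
    by (rule poly_eqI_of_nat)
  then show False
    using assms(3) val_bounds(1)[OF finite_verts z] by (simp add: val_def)
qed

end
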